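(* For any infinite cardinal $\theta$, any Boolean algebra with a strictly positive probability measure satisfying the $\theta$-density property is $\theta$-intersection-linked.
   Context: For a Boolean algebra $\mathscr{B}$, $\mathscr{B}^{+} = \mathscr{B} \setminus \{0_{\mathscr{B}}\}$; a Boolean algebra is viewed as a forcing notion (preordered set) by taking $\mathscr{B}^+$ with the order of $\mathscr{B}$ (so lower bounds are nonzero). A probability measure on $\mathscr{B}$ is a function $\mu \colon \mathscr{B} \to [0, \infty]$ with $\mu(0_{\mathscr{B}}) = 0$, $\mu(1_{\mathscr{B}}) = 1$, and $\mu(\bigvee_{n<\omega} b_n) = \sum_{n<\omega} \mu(b_n)$ whenever $\{b_n \colon n<\omega\} \subseteq \mathscr{B}$, $\bigvee_{n<\omega} b_n$ exists in $\mathscr{B}$, and $b_m \wedge b_n = 0_{\mathscr{B}}$ for $m \neq n$. It is strictly positive if $\mu(b) > 0$ for all $b \in \mathscr{B}^{+}$. For $s \in \mathscr{B}$ with $\mu(s)>0$, $\mu_s(a) := \mu(a \wedge s)/\mu(s)$ for $a \in \mathscr{B}$. A strictly positive probability measure $\mu$ satisfies the $\theta$-density property if there is $S \subseteq \mathscr{B}^{+}$ with $|S| \leq \theta$ such that for any $\varepsilon > 0$ and $b \in \mathscr{B}^{+}$ there is some $s \in S$ with $\mu_s(b) \geq 1 - \varepsilon$. For a forcing notion $\mathbb{P}$ and $\bar{q} = \langle q_i \colon i < n\rangle \in {}^{n}\mathbb{P}$, let $i_{\ast}^{\mathbb{P}}(\bar{q}) := \max\{ |F| \colon F \subseteq n=\{0,\dots,n-1\}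 \text{ and } \{q_i \colon i \in F\} \text{ has a lower bound in } \mathbb{P}\}$, and for $Q \subseteq \mathbb{P}$ let $\mathrm{int}^{\mathbb{P}}(Q) := \inf\{ i_{\ast}^{\mathbb{P}}(\bar{q})/n \colon \bar{q} \in {}^{n}Q,\ n \in \omega \setminus \{0\}\}$ (with $\inf\emptyset = +\infty$). For an infinite cardinal $\theta$, a forcing notion $\mathbb{P}$ is $\theta$-intersection-linked if there is a family $\langle Q_{\alpha,\varepsilon} \colon \alpha < \theta,\ \varepsilon \in (0,1) \cap \mathbb{Q}\rangle$ of subsets of $\mathbb{P}$ (here $\mathbb{Q}$ denotes the rationals) such that: (1) $\mathrm{int}^{\mathbb{P}}(Q_{\alpha,\varepsilon}) \geq 1 - \varepsilon$ for all $\alpha<\theta$ and all $\varepsilon$; (2) $\bigcup_{\alpha<\theta} Q_{\alpha,\varepsilon}$ is dense in $\mathbb{P}$ for every $\varepsilon$. *)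

theory Defs
  imports "HOL-Library.Extended_Nonnegative_Real" "HOL-Library.Lub_Glb"
begin

unbundle cardinal_syntax

text \<open>A forcing notion is a preordered set, given by a carrier \<open>P\<close> and a relation \<open>le\<close>,
  of which only the restriction to \<open>P\<close> matters.\<close>

definition forcing_notion :: "'a set \<Rightarrow> ('a \<Rightarrow> 'a \<Rightarrow> bool) \<Rightarrow> bool" where
  "forcing_notion P le \<longleftrightarrow> reflp_on P le \<and> transp_on P le"

definition has_lower_bound :: "'a set \<Rightarrow> ('a \<Rightarrow> 'a \<Rightarrow> bool) \<Rightarrow> 'a set \<Rightarrow> bool" where
  "has_lower_bound P le A \<longleftrightarrow> (\<exists>p\<in>P. \<forall>a\<in>A. le p a)"

definition dense_in :: "'a set \<Rightarrow> ('a \<Rightarrow> 'a \<Rightarrow> bool) \<Rightarrow> 'a set \<Rightarrow> bool" where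
  "dense_in P le D \<longleftrightarrow> D \<subseteq> P \<and> (\<forall>p\<in>P. \<exists>d\<in>D. le d p)"

text \<open>An \<open>n\<close>-tuple is represented by a function on \<^typ>\<open>nat\<close> whose values
  at arguments \<open>\<ge> n\<close> are irrelevant.\<close>

definition i_star :: "'a set \<Rightarrow> ('a \<Rightarrow> 'a \<Rightarrow> bool) \<Rightarrow> nat \<Rightarrow> (nat \<Rightarrow> 'a) \<Rightarrow> nat" where
  "i_star P le n q = Max {card F | F. F \<subseteq> {..<n} \<and> has_lower_bound P le (q ` F)}"

text \<open>The infimum is taken in \<^typ>\<open>ereal\<close>, so that it is \<open>\<infinity>\<close> for \<open>Q = {}\<close>.\<close>

definition int_number :: "'a set \<Rightarrow> ('a \<Rightarrow> 'a \<Rightarrow> bool) \<Rightarrow> 'a set \<Rightarrow> ereal" where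
  "int_number P le Q =
     Inf {ereal (real (i_star P le n q) / real n) | n q. n \<noteq> 0 \<and> (\<forall>i<n. q i \<in> Q)}"

text \<open>A cardinal \<open>\<theta>\<close> is a well-order satisfying \<^const>\<open>Card_order\<close>;
  its field plays the role of the set of ordinals \<open>\<alpha> < \<theta>\<close>.\<close>

definition intersection_linked ::
    "'i rel \<Rightarrow> 'a set \<Rightarrow> ('a \<Rightarrow> 'a \<Rightarrow> bool) \<Rightarrow> bool" where
  "intersection_linked \<theta> P le \<longleftrightarrow>
     forcing_notion P le \<and>
     (\<exists>Q :: 'i \<Rightarrow> real \<Rightarrow> 'a set.
        (\<forall>\<alpha>\<in>Field \<theta>. \<forall>\<epsilon>\<in>{0<..<1} \<inter> \<rat>. Q \<alpha> \<epsilon> \<subseteq> P \<and> int_number P le (Q \<alpha> \<epsilon>) \<ge> ereal (1 - \<epsilon>)) \<and>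
        (\<forall>\<epsilon>\<in>{0<..<1} \<inter> \<rat>. dense_in P le (\<Union>\<alpha>\<in>Field \<theta>. Q \<alpha> \<epsilon>)))"

definition nonzero :: "'b::boolean_algebra set" where
  "nonzero = UNIV - {bot}"

text \<open>Countable joins need not exist in the algebra; additivity is only required for those that do.\<close>

definition probability_measure :: "('b::boolean_algebra \<Rightarrow> ennreal) \<Rightarrow> bool" where
  "probability_measure \<mu> \<longleftrightarrow>
     \<mu> bot = 0 \<and> \<mu> top = 1 \<and>
     (\<forall>(b :: nat \<Rightarrow> 'b) s.
        isLub UNIV (range b) s \<longrightarrow> (\<forall>m n. m \<noteq> n \<longrightarrow> inf (b m) (b n) = bot) \<longrightarrow>
        \<mu> s = (\<Sum>n. \<mu> (b n)))"

definition strictly_positive :: "('b::boolean_algebra \<Rightarrow> ennreal) \<Rightarrow> bool" where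
  "strictly_positive \<mu> \<longleftrightarrow> (\<forall>b\<in>nonzero. \<mu> b > 0)"

definition rel_measure :: "('b::boolean_algebra \<Rightarrow> ennreal) \<Rightarrow> 'b \<Rightarrow> 'b \<Rightarrow> ennreal" where
  "rel_measure \<mu> s a = \<mu> (inf a s) / \<mu> s"

text \<open>For \<open>\<epsilon> > 1\<close>, \<^term>\<open>ennreal (1 - \<epsilon>)\<close> is \<open>0\<close>, and the inequality holds trivially,
  as it does for the negative number \<open>1 - \<epsilon>\<close>.\<close>

definition density_property :: "'i rel \<Rightarrow> ('b::boolean_algebra \<Rightarrow> ennreal) \<Rightarrow> bool" where
  "density_property \<theta> \<mu> \<longleftrightarrow>
     (\<exists>S \<subseteq> nonzero. |S| \<le>o \<theta> \<and>
        (\<forall>\<epsilon>::real. \<epsilon> > 0 \<longrightarrow> (\<forall>b\<in>nonzero. \<exists>s\<in>S. rel_measure \<mu> s b \<ge> ennreal (1 - \<epsilon>))))"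

end

theory Submission
  imports Defs
begin

text \<open>
  Let \<open>S\<close> witness the density property, and enumerate it as \<open>s \<alpha>\<close> with \<open>\<alpha> < \<theta>\<close>. Put
  \<open>Q \<alpha> \<epsilon> = {b. \<mu>\<^sub>s(b) \<ge> 1 - \<epsilon>}\<close> for \<open>s = s \<alpha>\<close>. The density property says that, for each
  \<open>\<epsilon>\<close>, these sets cover all of \<open>nonzero\<close>, which is more than density of their union.

  For the intersection numbers, regard \<open>b\<^sub>0, \<dots>, b\<^sub>n\<^sub>-\<^sub>1 \<in> Q \<alpha> \<epsilon>\<close> as events of probability at
  least \<open>1 - \<epsilon>\<close> under \<open>\<mu>\<^sub>s\<close>. The expected number of these events that occur is then
  at least \<open>n (1 - \<epsilon>)\<close>. On the other hand it cannot exceed the largest size of a subfamily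
  with nonzero meet, which is the content of \<open>sum_measure_le_if_meeting_bounded\<close>.
  Hence some subfamily of size at least \<open>n (1 - \<epsilon>)\<close> has a nonzero lower bound.
\<close>

text \<open>Finite joins always exist, so countable additivity applies to \<open>a, b, \<bottom>, \<bottom>, \<dots>\<close>.\<close>

lemma probability_measure_sup:
  assumes "probability_measure \<mu>" and disjoint: "inf a b = bot"
  shows "\<mu> (sup a b) = \<mu> a + \<mu> b"
proof -
  define c :: "nat \<Rightarrow> 'a" where "c n = (if n = 0 then a else if n = 1 then b else bot)" for n
  have "isLub UNIV (range c) (sup a b)"
  proof (rule isLubI2)
    show "isUb UNIV (range c) (sup a b)"
      by (auto simp: isUb_def setle_def c_def)
    show "sup a b <=* Collect (isUb UNIV (range c))"
    proof (intro setgeI ballI)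
      fix u assume "u \<in> Collect (isUb UNIV (range c))"
      then have "c 0 \<le> u" "c 1 \<le> u"
        by (auto simp: isUb_def setle_def)
      then show "sup a b \<le> u" by (simp add: c_def)
    qed
  qed
  moreover have "\<forall>m n. m \<noteq> n \<longrightarrow> inf (c m) (c n) = bot"
    using disjoint by (auto simp: c_def inf_commute)
  ultimately have "\<mu> (sup a b) = (\<Sum>n. \<mu> (c n))"
    using assms(1) by (simp add: probability_measure_def)
  also have "\<dots> = (\<Sum>n\<in>{0,1}. \<mu> (c n))"
    using assms(1) by (intro suminf_finite) (auto simp: c_def probability_measure_def)
  finally show ?thesis by (simp add: c_def)
qed

lemma probability_measure_split:
  assumes "probability_measure \<mu>"
  shows "\<mu> a = \<mu> (inf a b) + \<mu> (inf a (- b))"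
proof -
  have "sup (inf a b) (inf a (- b)) = a"
    by (simp flip: inf_sup_distrib1)
  moreover have "inf (inf a b) (inf a (- b)) = bot"
    by (simp add: inf.assoc inf.left_commute)
  ultimately show ?thesis
    using probability_measure_sup[OF assms, of "inf a b" "inf a (- b)"] by simp
qed

lemma probability_measure_le_1:
  assumes "probability_measure \<mu>"
  shows "\<mu> a \<le> 1"
proof -
  have "\<mu> top = \<mu> a + \<mu> (- a)"
    using probability_measure_split[OF assms, of top a] by simp
  also have "\<dots> \<ge> \<mu> a"
    by simp
  finally show ?thesis
    using assms by (simp add: probability_measure_def)
qed

text \<open>If a point below \<open>s\<close> never lies in more than \<open>k\<close> of the \<open>q i\<close>, then integrating the
  number of \<open>q i\<close> that contain it gives at most \<open>k * \<mu> s\<close>. An abstract algebra has no points, so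
  the integral is replaced by splitting \<open>s\<close> along one \<open>q i\<close> at a time. Inside
  the last \<open>q n\<close> at most \<open>k - 1\<close> of the others can have a common part, and what \<open>q n\<close> itself
  contributes there makes up for the difference.\<close>

lemma sum_measure_le_if_meeting_bounded:
  fixes \<mu> :: "'b::boolean_algebra \<Rightarrow> ennreal" and q :: "nat \<Rightarrow> 'b"
  assumes "probability_measure \<mu>"
    and "\<And>F p. F \<subseteq> {..<n} \<Longrightarrow> p \<noteq> bot \<Longrightarrow> p \<le> s \<Longrightarrow> \<forall>i\<in>F. p \<le> q i \<Longrightarrow> card F \<le> k"
  shows "(\<Sum>i<n. \<mu> (inf (q i) s)) \<le> of_nat k * \<mu> s"
  using assms(2)
proof (induction n arbitrary: s k)
  case 0
  show ?case by simp
next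
  case (Suc n)
  note split = probability_measure_split[OF assms(1)]
  define t u where "t = inf s (q n)" and "u = inf s (- q n)"
  have outside: "(\<Sum>i<n. \<mu> (inf (q i) u)) \<le> of_nat k * \<mu> u"
  proof (rule Suc.IH)
    fix F p assume "F \<subseteq> {..<n}" "p \<noteq> bot" "p \<le> u" "\<forall>i\<in>F. p \<le> q i"
    then show "card F \<le> k"
      by (intro Suc.prems[of F p]) (auto simp: u_def)
  qed
  have inside: "\<mu> t + (\<Sum>i<n. \<mu> (inf (q i) t)) \<le> of_nat k * \<mu> t"
  proof (cases "t = bot")
    case True
    then show ?thesis using assms(1) by (simp add: probability_measure_def)
  next
    case False
    have card_less: "card F < k"
      if "F \<subseteq> {..<n}" "p \<noteq> bot" "p \<le> t" "\<forall>i\<in>F. p \<le> q i" for F p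
    proof -
      have "card (insert n F) \<le> k"
        using that by (intro Suc.prems[of _ p]) (auto simp: t_def)
      moreover have "finite F" "n \<notin> F"
        using that(1) finite_subset by auto
      ultimately show ?thesis by simp
    qed
    have "k > 0" using card_less[of "{}" t] False by simp
    have "(\<Sum>i<n. \<mu> (inf (q i) t)) \<le> of_nat (k - 1) * \<mu> t"
    proof (rule Suc.IH)
      fix F p assume "F \<subseteq> {..<n}" "p \<noteq> bot" "p \<le> t" "\<forall>i\<in>F. p \<le> q i"
      from card_less[OF this] show "card F \<le> k - 1" by simp
    qed
    then have "\<mu> t + (\<Sum>i<n. \<mu> (inf (q i) t)) \<le> \<mu> t + of_nat (k - 1) * \<mu> t"
      by (rule add_left_mono)
    also have "\<dots> = of_nat (Suc (k - 1)) * \<mu> t"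
      by (simp add: distrib_right)
    finally show ?thesis using \<open>k > 0\<close> by simp
  qed
  have "\<mu> (inf (q i) s) = \<mu> (inf (q i) t) + \<mu> (inf (q i) u)" for i
    using split[of "inf (q i) s" "q n"] by (simp add: t_def u_def inf.assoc)
  then have "(\<Sum>i<n. \<mu> (inf (q i) s)) =
      (\<Sum>i<n. \<mu> (inf (q i) t)) + (\<Sum>i<n. \<mu> (inf (q i) u))"
    by (simp add: sum.distrib)
  moreover have "inf (q n) s = t"
    by (simp add: t_def inf_commute)
  ultimately have "(\<Sum>i<Suc n. \<mu> (inf (q i) s)) =
      (\<mu> t + (\<Sum>i<n. \<mu> (inf (q i) t))) + (\<Sum>i<n. \<mu> (inf (q i) u))"
    by (simp add: ac_simps)
  also have "\<dots> \<le> of_nat k * \<mu> t + of_nat k * \<mu> u"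
    by (rule add_mono[OF inside outside])
  also have "\<dots> = of_nat k * \<mu> s"
    using split[of s "q n"] by (simp add: t_def u_def distrib_left)
  finally show ?case .
qed

lemma card_le_i_star:
  assumes "F \<subseteq> {..<n}" "has_lower_bound P le (q ` F)"
  shows "card F \<le> i_star P le n q"
  unfolding i_star_def
proof (rule Max_ge)
  have "{card F | F. F \<subseteq> {..<n} \<and> has_lower_bound P le (q ` F)} \<subseteq> card ` Pow {..<n}"
    by auto
  then show "finite {card F | F. F \<subseteq> {..<n} \<and> has_lower_bound P le (q ` F)}"
    by (rule finite_subset) simp
qed (use assms in blast)

text \<open>The averaging argument for elements that each fill a proportion \<open>c\<close> of \<open>s\<close>.
  Dividing by \<open>\<mu> s\<close> is where positivity and finiteness of the measure of \<open>s\<close> enter.\<close>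

lemma int_number_ge_if_rel_measure_ge:
  fixes \<mu> :: "'b::boolean_algebra \<Rightarrow> ennreal"
  assumes "probability_measure \<mu>" "\<mu> s > 0" "c \<ge> 0"
    and Q: "\<And>b. b \<in> Q \<Longrightarrow> rel_measure \<mu> s b \<ge> ennreal c"
  shows "int_number nonzero (\<le>) Q \<ge> ereal c"
  unfolding int_number_def
proof (rule Inf_greatest, clarify)
  fix n :: nat and q :: "nat \<Rightarrow> 'b"
  assume n: "n > 0" and q: "\<forall>i<n. q i \<in> Q"
  let ?k = "i_star nonzero (\<le>) n q"
  have finite: "\<mu> s < top"
    using probability_measure_le_1[OF assms(1), of s] by (simp add: le_less_trans)
  have proportion: "ennreal c * \<mu> s \<le> \<mu> (inf b s)" if "b \<in> Q" for b
  proof -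
    have "ennreal c * \<mu> s \<le> \<mu> (inf b s) / \<mu> s * \<mu> s"
      using Q[OF that] by (intro mult_right_mono) (auto simp: rel_measure_def)
    also have "\<dots> = \<mu> (inf b s)"
      using assms(2) finite by (simp add: ennreal_divide_times ennreal_divide_self)
    finally show ?thesis .
  qed
  have "of_nat n * (ennreal c * \<mu> s) = (\<Sum>i<n. ennreal c * \<mu> s)"
    by simp
  also have "\<dots> \<le> (\<Sum>i<n. \<mu> (inf (q i) s))"
    using q proportion by (intro sum_mono) auto
  also have "\<dots> \<le> of_nat ?k * \<mu> s"
  proof (rule sum_measure_le_if_meeting_bounded[OF assms(1)])
    fix F p assume "F \<subseteq> {..<n}" "p \<noteq> bot" "\<forall>i\<in>F. p \<le> q i"
    then show "card F \<le> ?k"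
      by (intro card_le_i_star) (auto simp: has_lower_bound_def nonzero_def)
  qed
  finally have "\<mu> s * ennreal (real n * c) \<le> \<mu> s * ennreal (real ?k)"
    by (simp add: ennreal_mult assms(3) ennreal_of_nat_eq_real_of_nat ac_simps)
  then have "ennreal (real n * c) \<le> ennreal (real ?k)"
    using assms(2) finite by (simp add: ennreal_mult_le_mult_iff)
  then have "real n * c \<le> real ?k"
    by simp
  then show "ereal c \<le> ereal (real ?k / real n)"
    using n by (simp add: field_simps)
qed

lemma card_of_ordLeq_imp_image:
  assumes "Card_order \<theta>" "|A| \<le>o \<theta>" "A \<noteq> {}"
  shows "\<exists>g. g ` Field \<theta> = A"
proof -
  have "|A| \<le>o |Field \<theta>|"
    using assms(2) ordIso_symmetric[OF card_of_Field_ordIso[OF assms(1)]]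
    by (rule ordLeq_ordIso_trans)
  then show ?thesis using card_of_ordLeq2[OF assms(3)] by blast
qed

theorem theorem4p10:
  fixes \<theta> :: "'i rel" and \<mu> :: "'b::boolean_algebra \<Rightarrow> ennreal"
  assumes "Card_order \<theta>" and "infinite (Field \<theta>)"
    and "probability_measure \<mu>" and "strictly_positive \<mu>"
    and "density_property \<theta> \<mu>"
  shows "intersection_linked \<theta> (nonzero :: 'b set) (\<le>)"
proof -
  obtain S where S: "S \<subseteq> nonzero" "|S| \<le>o \<theta>"
    and dense: "\<And>\<epsilon> b. \<epsilon> > 0 \<Longrightarrow> b \<in> nonzero \<Longrightarrow> \<exists>s\<in>S. rel_measure \<mu> s b \<ge> ennreal (1 - \<epsilon>)"
    using assms(5) unfolding density_property_def by blast
  have "(top :: 'b) \<noteq> bot"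
    using assms(3) by (metis probability_measure_def zero_neq_one)
  then have "S \<noteq> {}"
    using dense[of 1 top] by (auto simp: nonzero_def)
  then obtain s where s: "s ` Field \<theta> = S"
    using card_of_ordLeq_imp_image[OF assms(1) S(2)] by blast
  define Q where "Q \<alpha> \<epsilon> = {b \<in> nonzero. rel_measure \<mu> (s \<alpha>) b \<ge> ennreal (1 - \<epsilon>)}" for \<alpha> \<epsilon>
  have "forcing_notion (nonzero :: 'b set) (\<le>)"
    by (auto simp: forcing_notion_def reflp_on_def transp_on_def)
  moreover have "int_number nonzero (\<le>) (Q \<alpha> \<epsilon>) \<ge> ereal (1 - \<epsilon>)"
    if "\<alpha> \<in> Field \<theta>" "\<epsilon> \<in> {0<..<1}" for \<alpha> \<epsilon>
  proof (rule int_number_ge_if_rel_measure_ge[OF assms(3)])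
    show "\<mu> (s \<alpha>) > 0"
      using assms(4) S(1) s that(1) unfolding strictly_positive_def by blast
  qed (use that(2) in \<open>auto simp: Q_def\<close>)
  moreover have "dense_in nonzero (\<le>) (\<Union>\<alpha>\<in>Field \<theta>. Q \<alpha> \<epsilon>)" if "\<epsilon> > 0" for \<epsilon>
  proof -
    have "b \<in> (\<Union>\<alpha>\<in>Field \<theta>. Q \<alpha> \<epsilon>)" if "b \<in> nonzero" for b
      using dense[OF \<open>\<epsilon> > 0\<close> that] that by (auto simp: Q_def simp flip: s)
    then show ?thesis
      by (force simp: dense_in_def Q_def)
  qed
  moreover have "Q \<alpha> \<epsilon> \<subseteq> nonzero" for \<alpha> \<epsilon>
    by (auto simp: Q_def)
  ultimately show ?thesis
    unfolding intersection_linked_def by (intro conjI exI[of _ Q]) auto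
qed

end
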